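(* Let $\mathsf T$ be the stopping time of the AQuTe-CUSUM procedure with window size $w\ge1$ and detection threshold $\nu=\log\gamma$, where $\gamma>1$. Then the average run length satisfies $$\mathsf E_\infty[\mathsf T]>\gamma.$$
   Context: Data model. $\{p_X(\cdot;\theta):\theta\in\Theta\}$, $\Theta\subset\mathbb R$, is a parametric family of densities on $\mathcal X\subseteq\mathbb R$. The parameter $\theta_0\in\Theta$ is the known pre-change parameter, and $\Theta_1\subset\Theta$ is a compact set of candidate post-change parameters with $\theta_0\notin\Theta_1$. $\mathsf E_\infty$ denotes expectation when no change ever occurs, i.e. $X_1,X_2,\dots$ are i.i.d. with density $p_X(\cdot;\theta_0)$, and the thresholds are those of the AQuTe-CUSUM procedure below. 1-bit measurements. The $X_t$ are not observed; one observes $B_t=1$ if $X_t\le\tau_t$ and $B_t=-1$ if $X_t>\tau_t$, where the threshold $\tau_t$ lies in the interior of $\mathcal X$ and in a fixed bounded interval $[\tau_{\min},\tau_{\max}]$ with $\tau_{\min},\tau_{\max}\in\mathcal X$. For $b\in\{-1,1\}$, $p_B(b;\theta,\tau)$ is the probability that the bit equals $b$ when $X\sim p_X(\cdot;\theta)$ and the threshold is $\tau$: $p_B(1;\theta,\tau)=\int_{\{x\in\mathcal X:x\le\tau\}}p_X(x;\theta)\,dx$ and $p_B(-1;\theta,\tau)=\int_{\{x\in\mathcal X:x>\tau\}}p_X(x;\theta)\,dx$. Let $\mathscr F_t=\sigma\{B_1,\dots,B_t\}$, with $\mathscr F_0$ trivial. 1-bit KL divergence: $\mathsf{KL}(\theta,\tau)=\sum_{b\in\{-1,1\}}p_B(b;\theta,\tau)\log\frac{p_B(b;\theta,\tau)}{p_B(b;\theta_0,\tau)}$.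 AQuTe-CUSUM procedure, with window size $w\ge1$ and detection threshold $\nu$. The thresholds $\tau_1,\dots,\tau_w\in[\tau_{\min},\tau_{\max}]$ are initialized randomly, and $\mathsf S_1=\dots=\mathsf S_w=0$. For $t>w$: (i) $\hat\theta_{t-1}=\arg\max_{\theta\in\Theta_1}\sum_{s=t-w}^{t-1}\log p_B(B_s;\theta,\tau_s)$ (an $\mathscr F_{t-1}$-measurable maximizer); (ii) $\tau_t=\arg\max_{\tau\in[\tau_{\min},\tau_{\max}]}\mathsf{KL}(\hat\theta_{t-1},\tau)$, also $\mathscr F_{t-1}$-measurable; (iii) $B_t$ is observed using threshold $\tau_t$; (iv) $\mathsf S_t=\mathsf S_{t-1}^++\log\frac{p_B(B_t;\hat\theta_{t-1},\tau_t)}{p_B(B_t;\theta_0,\tau_t)}$, where $x^+=\max\{x,0\}$. The stopping time is $\mathsf T=\inf\{t>w:\mathsf S_t\ge\nu\}$. *)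

theory Defs
  imports "HOL-Probability.Probability"
begin

definition density_on :: "real set \<Rightarrow> (real \<Rightarrow> real) \<Rightarrow> bool" where
  "density_on \<X> f \<longleftrightarrow>
     (\<forall>x\<in>\<X>. 0 \<le> f x) \<and> set_integrable lborel \<X> f \<and> (LINT x:\<X>|lborel. f x) = 1"

definition one_bit :: "real \<Rightarrow> real \<Rightarrow> int" where
  "one_bit x \<tau> = (if x \<le> \<tau> then 1 else -1)"

text \<open>Meaningful for \<open>b = 1\<close> and \<open>b = -1\<close> only.\<close>
definition p_B :: "(real \<Rightarrow> real \<Rightarrow> real) \<Rightarrow> real set \<Rightarrow> int \<Rightarrow> real \<Rightarrow> real \<Rightarrow> real" where
  "p_B p \<X> b \<theta> \<tau> =
     (if b = 1 then (LINT x:{x\<in>\<X>. x \<le> \<tau>}|lborel. p \<theta> x)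
      else (LINT x:{x\<in>\<X>. x > \<tau>}|lborel. p \<theta> x))"

text \<open>The model does not force the bit probabilities to be positive, while the library has
  \<open>ln 0 = 0\<close> and \<open>x / 0 = 0\<close> on the reals. Logarithms of probabilities and of their ratios are
  therefore taken in the extended reals, with \<open>log 0 = -\<infinity>\<close> and \<open>log (p / 0) = \<infinity>\<close> for \<open>p > 0\<close>.\<close>
definition elog :: "ereal \<Rightarrow> ereal" where
  "elog x = (if x \<le> 0 then -\<infinity> else if x = \<infinity> then \<infinity> else ereal (ln (real_of_ereal x)))"

definition log_ratio :: "(real \<Rightarrow> real \<Rightarrow> real) \<Rightarrow> real set \<Rightarrow> real \<Rightarrow> int \<Rightarrow> real \<Rightarrow> real \<Rightarrow> ereal" where
  "log_ratio p \<X> \<theta>0 b \<theta> \<tau> = elog (ereal (p_B p \<X> b \<theta> \<tau>) / ereal (p_B p \<X> b \<theta>0 \<tau>))"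

text \<open>Since \<open>0 * \<infinity> = 0 * (-\<infinity>) = 0\<close> in \<^typ>\<open>ereal\<close>, the usual convention \<open>0 log (0 / q) = 0\<close> holds.\<close>
definition KL_bit :: "(real \<Rightarrow> real \<Rightarrow> real) \<Rightarrow> real set \<Rightarrow> real \<Rightarrow> real \<Rightarrow> real \<Rightarrow> ereal" where
  "KL_bit p \<X> \<theta>0 \<theta> \<tau> = (\<Sum>b\<in>{-1, 1}. ereal (p_B p \<X> b \<theta> \<tau>) * log_ratio p \<X> \<theta>0 b \<theta> \<tau>)"

text \<open>In what follows \<open>B t \<omega>\<close>, \<open>\<tau> t \<omega>\<close> and \<open>\<theta>h t \<omega>\<close> are the bit, the threshold and the
  estimate at time \<open>t\<close>; time starts at \<open>1\<close> and values at index \<open>0\<close> are never used, except for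
  the dummy value \<open>S 0 = 0\<close>.\<close>

definition window_loglik ::
  "(real \<Rightarrow> real \<Rightarrow> real) \<Rightarrow> real set \<Rightarrow> nat \<Rightarrow> (nat \<Rightarrow> 'a \<Rightarrow> int) \<Rightarrow> (nat \<Rightarrow> 'a \<Rightarrow> real) \<Rightarrow>
   nat \<Rightarrow> 'a \<Rightarrow> real \<Rightarrow> ereal" where
  "window_loglik p \<X> w B \<tau> t \<omega> \<theta> =
     (\<Sum>s\<in>{t - w..t - 1}. elog (ereal (p_B p \<X> (B s \<omega>) \<theta> (\<tau> s \<omega>))))"

fun cusum_stat ::
  "(real \<Rightarrow> real \<Rightarrow> real) \<Rightarrow> real set \<Rightarrow> real \<Rightarrow> nat \<Rightarrow> (nat \<Rightarrow> 'a \<Rightarrow> int) \<Rightarrow> (nat \<Rightarrow> 'a \<Rightarrow> real) \<Rightarrow>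
   (nat \<Rightarrow> 'a \<Rightarrow> real) \<Rightarrow> nat \<Rightarrow> 'a \<Rightarrow> ereal" where
  "cusum_stat p \<X> \<theta>0 w B \<tau> \<theta>h 0 \<omega> = 0"
| "cusum_stat p \<X> \<theta>0 w B \<tau> \<theta>h (Suc n) \<omega> =
     (if Suc n \<le> w then 0
      else max (cusum_stat p \<X> \<theta>0 w B \<tau> \<theta>h n \<omega>) 0 +
           log_ratio p \<X> \<theta>0 (B (Suc n) \<omega>) (\<theta>h n \<omega>) (\<tau> (Suc n) \<omega>))"

text \<open>The infimum of the empty set is \<open>\<infinity>\<close>: no alarm is ever raised.\<close>
definition stop_time :: "nat \<Rightarrow> real \<Rightarrow> (nat \<Rightarrow> 'a \<Rightarrow> ereal) \<Rightarrow> 'a \<Rightarrow> enat" where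
  "stop_time w \<nu> S \<omega> = Inf (enat ` {t. t > w \<and> S t \<omega> \<ge> ereal \<nu>})"

definition bit_sigma :: "'a set \<Rightarrow> (nat \<Rightarrow> 'a \<Rightarrow> int) \<Rightarrow> nat \<Rightarrow> 'a measure" where
  "bit_sigma \<Omega> B t =
     vimage_algebra \<Omega> (\<lambda>\<omega>. \<lambda>s\<in>{1..t}. B s \<omega>) (Pi\<^sub>M {1..t} (\<lambda>_. count_space UNIV))"

definition init_thresholds :: "nat \<Rightarrow> (nat \<Rightarrow> 'a \<Rightarrow> real) \<Rightarrow> 'a \<Rightarrow> nat \<Rightarrow> real" where
  "init_thresholds w \<tau> \<omega> = (\<lambda>s\<in>{1..w}. \<tau> s \<omega>)"

text \<open>The information available after time \<open>t\<close>: the bits \<open>B 1, \<dots>, B t\<close> together with the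
  (random, but known) initial thresholds. The windowed likelihood involves the initial thresholds,
  so a maximiser is in general not a function of the bits alone. For deterministic initial
  thresholds this is just \<open>bit_sigma\<close>.\<close>
definition history :: "'a set \<Rightarrow> nat \<Rightarrow> (nat \<Rightarrow> 'a \<Rightarrow> int) \<Rightarrow> (nat \<Rightarrow> 'a \<Rightarrow> real) \<Rightarrow> nat \<Rightarrow> 'a measure" where
  "history \<Omega> w B \<tau> t = sigma \<Omega> (sets (bit_sigma \<Omega> B t) \<union>
     sets (vimage_algebra \<Omega> (init_thresholds w \<tau>) (Pi\<^sub>M {1..w} (\<lambda>_. borel))))"

lemma space_bit_sigma [simp]: "space (bit_sigma \<Omega> B t) = \<Omega>"
  by (simp add: bit_sigma_def)

lemma space_history [simp]: "space (history \<Omega> w B \<tau> t) = \<Omega>"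
  unfolding history_def
  by (subst space_measure_of) (use sets.space_closed in \<open>force simp: bit_sigma_def\<close>)+

lemma sets_bit_sigma_subset_history: "sets (bit_sigma \<Omega> B t) \<subseteq> sets (history \<Omega> w B \<tau> t)"
proof -
  have "sets (bit_sigma \<Omega> B t) \<union> sets (vimage_algebra \<Omega> (init_thresholds w \<tau>)
      (Pi\<^sub>M {1..w} (\<lambda>_. borel))) \<subseteq> Pow \<Omega>"
    using sets.space_closed[of "bit_sigma \<Omega> B t"]
      sets.space_closed[of "vimage_algebra \<Omega> (init_thresholds w \<tau>) (Pi\<^sub>M {1..w} (\<lambda>_. borel))"]
    by auto
  then show ?thesis
    unfolding history_def by (subst sets_measure_of) auto
qed

text \<open>Joint measurability of \<open>p_B\<close> in the parameter and the threshold is not part of the model.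
  The next two facts show that it is not needed when estimate and threshold are functions of
  finitely many bits: every function of them is then measurable as well.\<close>

lemma bit_sigma_finite_comp:
  fixes f g :: "'a \<Rightarrow> real" and h :: "real \<Rightarrow> real \<Rightarrow> real"
  assumes f: "f \<in> borel_measurable (bit_sigma \<Omega> B t)"
    and g: "g \<in> borel_measurable (bit_sigma \<Omega> B t)"
    and B: "\<And>s \<omega>. B s \<omega> \<in> {-1, 1}"
  shows "(\<lambda>\<omega>. h (f \<omega>) (g \<omega>)) \<in> borel_measurable (bit_sigma \<Omega> B t)"
proof -
  let ?v = "\<lambda>\<omega>. \<lambda>s\<in>{1..t}. B s \<omega>"
  let ?P = "Pi\<^sub>M {1..t} (\<lambda>_. count_space (UNIV :: int set))"
  let ?C = "\<Pi>\<^sub>E s\<in>{1..t}. {-1, 1 :: int}"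
  have fin: "finite ?C" by (intro finite_PiE) auto
  have vC: "?v \<omega> \<in> ?C" for \<omega> using B by (auto simp: PiE_iff)
  have vs: "?v \<in> \<Omega> \<rightarrow> space ?P" by (auto simp: space_PiM)
  have const: "u \<omega> = u \<omega>'"
    if u: "u \<in> borel_measurable (bit_sigma \<Omega> B t)" and \<omega>: "\<omega> \<in> \<Omega>" "\<omega>' \<in> \<Omega>" and eq: "?v \<omega> = ?v \<omega>'"
    for u :: "'a \<Rightarrow> real" and \<omega> \<omega>'
  proof -
    have "u -` {u \<omega>} \<inter> \<Omega> \<in> sets (bit_sigma \<Omega> B t)"
      using measurable_sets[OF u, of "{u \<omega>}"] by simp
    then obtain A where "u -` {u \<omega>} \<inter> \<Omega> = ?v -` A \<inter> \<Omega>"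
      unfolding bit_sigma_def sets_vimage_algebra2[OF vs] by auto
    then show ?thesis using \<omega> eq by (metis (no_types, lifting) IntE IntI singletonD singletonI vimageE vimageI2)
  qed
  have atom: "?v -` {c} \<inter> \<Omega> \<in> sets (bit_sigma \<Omega> B t)" if "c \<in> ?C" for c
  proof -
    have "c \<in> extensional {1..t}" using that by (auto simp: PiE_iff)
    then have "{c} = (\<Pi>\<^sub>E s\<in>{1..t}. {c s})" by (simp only: PiE_singleton)
    also have "\<dots> \<in> sets ?P" by (intro sets_PiM_I_finite) auto
    finally show ?thesis unfolding bit_sigma_def by (rule in_vimage_algebra)
  qed
  show ?thesis
  proof (rule measurableI)
    fix A :: "real set"
    let ?D = "{c \<in> ?C. \<exists>\<omega>\<in>\<Omega>. ?v \<omega> = c \<and> h (f \<omega>) (g \<omega>) \<in> A}"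
    have "(\<lambda>\<omega>. h (f \<omega>) (g \<omega>)) -` A \<inter> space (bit_sigma \<Omega> B t) = (\<Union>c\<in>?D. ?v -` {c} \<inter> \<Omega>)"
      (is "?L = ?R")
    proof (intro set_eqI iffI)
      fix \<omega> assume "\<omega> \<in> ?L"
      then show "\<omega> \<in> ?R" using vC[of \<omega>] by auto
    next
      fix \<omega> assume "\<omega> \<in> ?R"
      then obtain \<omega>' where "\<omega> \<in> \<Omega>" "\<omega>' \<in> \<Omega>" "?v \<omega>' = ?v \<omega>" "h (f \<omega>') (g \<omega>') \<in> A" by auto
      moreover from this have "f \<omega>' = f \<omega>" "g \<omega>' = g \<omega>" using const[OF f] const[OF g] by blast+
      ultimately show "\<omega> \<in> ?L" by simp
    qed
    also have "\<dots> \<in> sets (bit_sigma \<Omega> B t)"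
      using fin atom by (intro sets.finite_UN) auto
    finally show "(\<lambda>\<omega>. h (f \<omega>) (g \<omega>)) -` A \<inter> space (bit_sigma \<Omega> B t) \<in> sets (bit_sigma \<Omega> B t)" .
  qed simp
qed

lemma history_finite_comp:
  fixes f g :: "'a \<Rightarrow> real" and h :: "real \<Rightarrow> real \<Rightarrow> real"
  assumes "f \<in> borel_measurable (bit_sigma \<Omega> B t)"
    and "g \<in> borel_measurable (bit_sigma \<Omega> B t)"
    and "\<And>s \<omega>. B s \<omega> \<in> {-1, 1}"
  shows "f \<in> borel_measurable (history \<Omega> w B \<tau> t)"
    and "g \<in> borel_measurable (history \<Omega> w B \<tau> t)"
    and "(\<lambda>\<omega>. h (f \<omega>) (g \<omega>)) \<in> borel_measurable (history \<Omega> w B \<tau> t)"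
proof -
  have "u \<in> borel_measurable (history \<Omega> w B \<tau> t)"
    if "u \<in> borel_measurable (bit_sigma \<Omega> B t)" for u :: "'a \<Rightarrow> real"
    using that sets_bit_sigma_subset_history[of \<Omega> B t w \<tau>] by (auto simp: measurable_def)
  then show "f \<in> borel_measurable (history \<Omega> w B \<tau> t)"
    and "g \<in> borel_measurable (history \<Omega> w B \<tau> t)"
    and "(\<lambda>\<omega>. h (f \<omega>) (g \<omega>)) \<in> borel_measurable (history \<Omega> w B \<tau> t)"
    using assms bit_sigma_finite_comp[OF assms] by blast+
qed

end

(* The CUSUM statistic is dominated by a Shiryaev-Roberts statistic: put R_n = 0 for n <= w and
   R_(n+1) = (1 + R_n) L_(n+1), where L_t is the plug-in likelihood ratio of the t-th bit. Then
   exp (max S_n 0) <= 1 + R_n for n >= w, so R has reached gamma by the time T. Estimate and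
   threshold depend on the past only, and X_t is independent of the past, so
   E[L_t | past] <= 1 and R_n - n is a supermartingale. Stopping at the first crossing of gamma
   gives gamma * P(crossing) <= E[crossing time] - w, and w >= 1 makes the inequality strict. *)
theory Submission
  imports Defs
begin

text \<open>The reset at 0 makes the exponentiated CUSUM statistic a maximum, over starting times,
  of products of ratios. \<open>R n\<close> is the sum of these products over the starting times
  w+1, ..., n. It dominates the maximum, and its drift can be computed: each step adds 1 and then
  multiplies by a ratio of conditional mean at most 1. Bit probabilities may vanish, so a ratio can
  be 0 or infinite. Ratios and \<open>R\<close> therefore live in \<open>ennreal\<close>, and
  subtraction waits until everything is restricted to the event that \<open>R\<close> has stayed
  below \<gamma>. Conditioning on the past is replaced by a product law: the identity map into the
  algebra of past events is independent of the next observation, so the past can be frozen while the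
  observation is integrated out.\<close>

section \<open>Independent pairs and product laws\<close>

lemma emeasure_pair_assoc:
  assumes "sigma_finite_measure b" "sigma_finite_measure c" "A \<in> sets ((a \<Otimes>\<^sub>M b) \<Otimes>\<^sub>M c)"
  shows "emeasure ((a \<Otimes>\<^sub>M b) \<Otimes>\<^sub>M c) A =
    emeasure (a \<Otimes>\<^sub>M (b \<Otimes>\<^sub>M c)) ((\<lambda>(x, y, z). ((x, y), z)) -` A \<inter> space (a \<Otimes>\<^sub>M (b \<Otimes>\<^sub>M c)))"
proof -
  interpret b: sigma_finite_measure b by fact
  interpret c: sigma_finite_measure c by fact
  interpret bc: pair_sigma_finite b c by unfold_locales
  note [measurable] = assms(3)
  let ?f = "\<lambda>(x, y, z). ((x, y), z)"
  have f [measurable]: "?f \<in> a \<Otimes>\<^sub>M (b \<Otimes>\<^sub>M c) \<rightarrow>\<^sub>M (a \<Otimes>\<^sub>M b) \<Otimes>\<^sub>M c"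
    by measurable
  have "emeasure ((a \<Otimes>\<^sub>M b) \<Otimes>\<^sub>M c) A = (\<integral>\<^sup>+u. indicator A u \<partial>((a \<Otimes>\<^sub>M b) \<Otimes>\<^sub>M c))"
    by simp
  also have "\<dots> = (\<integral>\<^sup>+v. \<integral>\<^sup>+z. indicator A (v, z) \<partial>c \<partial>(a \<Otimes>\<^sub>M b))"
    by (rule c.nn_integral_fst[symmetric]) measurable
  also have "\<dots> = (\<integral>\<^sup>+x. \<integral>\<^sup>+y. \<integral>\<^sup>+z. indicator A ((x, y), z) \<partial>c \<partial>b \<partial>a)"
    by (rule b.nn_integral_fst[symmetric]) measurable
  also have "\<dots> = (\<integral>\<^sup>+x. \<integral>\<^sup>+v. indicator A (?f (x, v)) \<partial>(b \<Otimes>\<^sub>M c) \<partial>a)"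
    by (intro nn_integral_cong, subst c.nn_integral_fst[symmetric]) simp_all
  also have "\<dots> = (\<integral>\<^sup>+u. indicator A (?f u) \<partial>(a \<Otimes>\<^sub>M (b \<Otimes>\<^sub>M c)))"
    by (rule bc.P.nn_integral_fst) measurable
  also have "\<dots> = (\<integral>\<^sup>+u. indicator (?f -` A \<inter> space (a \<Otimes>\<^sub>M (b \<Otimes>\<^sub>M c))) u \<partial>(a \<Otimes>\<^sub>M (b \<Otimes>\<^sub>M c)))"
    by (intro nn_integral_cong) (simp add: indicator_def)
  also have "\<dots> = emeasure (a \<Otimes>\<^sub>M (b \<Otimes>\<^sub>M c)) (?f -` A \<inter> space (a \<Otimes>\<^sub>M (b \<Otimes>\<^sub>M c)))"
    by (rule nn_integral_indicator) measurable
  finally show ?thesis .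
qed

text \<open>The library's \<open>indep_var\<close> forces both variables to have the same type.\<close>
definition (in prob_space) indep_pair ::
  "'b measure \<Rightarrow> ('a \<Rightarrow> 'b) \<Rightarrow> 'c measure \<Rightarrow> ('a \<Rightarrow> 'c) \<Rightarrow> bool" where
  "indep_pair S X T Y \<longleftrightarrow> random_variable S X \<and> random_variable T Y \<and>
     distr M S X \<Otimes>\<^sub>M distr M T Y = distr M (S \<Otimes>\<^sub>M T) (\<lambda>\<omega>. (X \<omega>, Y \<omega>))"

lemma (in prob_space) indep_pairD:
  assumes "indep_pair S X T Y"
  shows "random_variable S X" "random_variable T Y"
    "distr M S X \<Otimes>\<^sub>M distr M T Y = distr M (S \<Otimes>\<^sub>M T) (\<lambda>\<omega>. (X \<omega>, Y \<omega>))"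
  using assms by (auto simp: indep_pair_def)

lemma (in prob_space) indep_pair_compose:
  assumes "indep_pair S X T Y" and [measurable]: "f \<in> S \<rightarrow>\<^sub>M S'" "g \<in> T \<rightarrow>\<^sub>M T'"
  shows "indep_pair S' (\<lambda>\<omega>. f (X \<omega>)) T' (\<lambda>\<omega>. g (Y \<omega>))"
proof -
  note XY = indep_pairD[OF assms(1)]
  note [measurable] = XY(1,2)
  interpret T': prob_space "distr (distr M T Y) T' g"
    by (intro prob_space.prob_space_distr prob_space_distr) measurable
  have "distr M S' (\<lambda>\<omega>. f (X \<omega>)) \<Otimes>\<^sub>M distr M T' (\<lambda>\<omega>. g (Y \<omega>)) =
      distr (distr M S X) S' f \<Otimes>\<^sub>M distr (distr M T Y) T' g"
    by (simp add: distr_distr comp_def)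
  also have "\<dots> = distr (distr M S X \<Otimes>\<^sub>M distr M T Y) (S' \<Otimes>\<^sub>M T') (\<lambda>(x, y). (f x, g y))"
    by (intro pair_measure_distr) (simp_all, unfold_locales)
  also have "\<dots> = distr M (S' \<Otimes>\<^sub>M T') (\<lambda>\<omega>. (f (X \<omega>), g (Y \<omega>)))"
    unfolding XY(3) by (subst distr_distr) (auto simp: comp_def)
  finally show ?thesis
    by (simp add: indep_pair_def)
qed

text \<open>The law of the triple is a product of three laws, and regrouping the factors moves
  \<open>V\<close> to the side of \<open>U\<close>. In the application \<open>U\<close> is the
  initial thresholds, \<open>V\<close> the past observations and \<open>W\<close> the next
  one.\<close>

lemma (in prob_space) indep_pair_assoc:
  assumes UVW: "indep_pair N U (P \<Otimes>\<^sub>M Q) (\<lambda>\<omega>. (V \<omega>, W \<omega>))" and VW: "indep_pair P V Q W"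
  shows "indep_pair (N \<Otimes>\<^sub>M P) (\<lambda>\<omega>. (U \<omega>, V \<omega>)) Q W"
proof -
  have UV: "indep_pair N U P V"
    using indep_pair_compose[OF UVW, of "\<lambda>x. x" N fst P] by simp
  note [measurable] = indep_pairD(1,2)[OF UV] indep_pairD(2)[OF VW]
  note eqs = UVW[THEN indep_pairD(3)] VW[THEN indep_pairD(3)] UV[THEN indep_pairD(3)]
  let ?a = "distr M N U" and ?b = "distr M P V" and ?c = "distr M Q W"
  interpret b: prob_space ?b by (rule prob_space_distr) measurable
  interpret c: prob_space ?c by (rule prob_space_distr) measurable
  let ?f = "\<lambda>(x, y, z). ((x, y), z)"
  have "distr M (N \<Otimes>\<^sub>M P) (\<lambda>\<omega>. (U \<omega>, V \<omega>)) \<Otimes>\<^sub>M ?c = (?a \<Otimes>\<^sub>M ?b) \<Otimes>\<^sub>M ?c"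
    using eqs by simp
  also have "\<dots> = distr M ((N \<Otimes>\<^sub>M P) \<Otimes>\<^sub>M Q) (\<lambda>\<omega>. ((U \<omega>, V \<omega>), W \<omega>))"
  proof (rule measure_eqI)
    fix A assume A: "A \<in> sets ((?a \<Otimes>\<^sub>M ?b) \<Otimes>\<^sub>M ?c)"
    then have A' [measurable]: "A \<in> sets ((N \<Otimes>\<^sub>M P) \<Otimes>\<^sub>M Q)"
      by (simp cong: sets_pair_measure_cong)
    have "emeasure ((?a \<Otimes>\<^sub>M ?b) \<Otimes>\<^sub>M ?c) A =
        emeasure (?a \<Otimes>\<^sub>M (?b \<Otimes>\<^sub>M ?c)) (?f -` A \<inter> space (?a \<Otimes>\<^sub>M (?b \<Otimes>\<^sub>M ?c)))"
      by (intro emeasure_pair_assoc A) unfold_locales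
    also have "?a \<Otimes>\<^sub>M (?b \<Otimes>\<^sub>M ?c) = distr M (N \<Otimes>\<^sub>M (P \<Otimes>\<^sub>M Q)) (\<lambda>\<omega>. (U \<omega>, V \<omega>, W \<omega>))"
      using eqs by simp
    also have "emeasure \<dots> (?f -` A \<inter> space \<dots>) =
        emeasure (distr \<dots> ((N \<Otimes>\<^sub>M P) \<Otimes>\<^sub>M Q) ?f) A"
      by (subst (2) emeasure_distr) auto
    also have "\<dots> = emeasure (distr M ((N \<Otimes>\<^sub>M P) \<Otimes>\<^sub>M Q) (\<lambda>\<omega>. ((U \<omega>, V \<omega>), W \<omega>))) A"
      by (subst distr_distr) (auto simp: comp_def)
    finally show "emeasure ((?a \<Otimes>\<^sub>M ?b) \<Otimes>\<^sub>M ?c) A = \<dots>" .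
  qed (simp cong: sets_pair_measure_cong)
  finally show ?thesis
    by (simp add: indep_pair_def)
qed

text \<open>This passes from independence of \<open>X\<close> to independence of the algebra
  generated by \<open>X\<close>, encoded as the identity map into it. Every event of that algebra is
  a preimage under \<open>X\<close>, so rectangles reduce to the known product law. Any function
  measurable for that algebra can then be plugged in as a function of the first coordinate.\<close>

lemma (in prob_space) indep_pair_vimage_algebra:
  assumes "indep_pair S X T Y"
  shows "indep_pair (vimage_algebra (space M) X S) (\<lambda>\<omega>. \<omega>) T Y"
proof -
  note XY = indep_pairD[OF assms]
  note [measurable] = XY(1,2)
  let ?G = "vimage_algebra (space M) X S"
  have X: "X \<in> space M \<rightarrow> space S"
    using measurable_space[OF XY(1)] by blast
  have "sets ?G \<subseteq> sets M"
    using XY(1) by (intro sets_image_in_sets) auto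
  then have id [measurable]: "random_variable ?G (\<lambda>\<omega>. \<omega>)"
    by (auto simp: measurable_def dest: sets.sets_into_space)
  interpret X: prob_space "distr M S X" by (rule prob_space_distr) measurable
  interpret Y: prob_space "distr M T Y" by (rule prob_space_distr) measurable
  interpret G: prob_space "distr M ?G (\<lambda>\<omega>. \<omega>)" by (rule prob_space_distr) measurable
  have "distr M ?G (\<lambda>\<omega>. \<omega>) \<Otimes>\<^sub>M distr M T Y = distr M (?G \<Otimes>\<^sub>M T) (\<lambda>\<omega>. (\<omega>, Y \<omega>))"
  proof (rule pair_measure_eqI)
    fix A B assume "A \<in> sets (distr M ?G (\<lambda>\<omega>. \<omega>))" and "B \<in> sets (distr M T Y)"
    then have A: "A \<in> sets ?G" and B [measurable]: "B \<in> sets T" by auto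
    then obtain A' where A' [measurable]: "A' \<in> sets S" and A_eq: "A = X -` A' \<inter> space M"
      by (auto simp: sets_vimage_algebra2[OF X])
    have "emeasure (distr M ?G (\<lambda>\<omega>. \<omega>)) A * emeasure (distr M T Y) B =
        emeasure (distr M S X) A' * emeasure (distr M T Y) B"
      using A by (simp add: emeasure_distr A_eq Int_assoc)
    also have "\<dots> = emeasure (distr M S X \<Otimes>\<^sub>M distr M T Y) (A' \<times> B)"
      by (simp add: Y.emeasure_pair_measure_Times)
    also have "\<dots> = emeasure (distr M (?G \<Otimes>\<^sub>M T) (\<lambda>\<omega>. (\<omega>, Y \<omega>))) (A \<times> B)"
      unfolding XY(3) using A
      by (subst (1 2) emeasure_distr) (auto simp: A_eq intro!: arg_cong[where f = "emeasure M"])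
    finally show "emeasure (distr M ?G (\<lambda>\<omega>. \<omega>)) A * emeasure (distr M T Y) B = \<dots>" .
  qed (unfold_locales, simp cong: sets_pair_measure_cong)
  then show ?thesis
    by (simp add: indep_pair_def)
qed

text \<open>The freezing form of Tonelli's theorem. With \<open>Y\<close> the identity into an
  algebra, the inner integral plays the role of the conditional expectation given that
  algebra.\<close>

lemma (in prob_space) nn_integral_indep_pair:
  assumes indep: "indep_pair S Y T Z" and g: "g \<in> borel_measurable (S \<Otimes>\<^sub>M T)"
  shows "(\<integral>\<^sup>+\<omega>. g (Y \<omega>, Z \<omega>) \<partial>M) = (\<integral>\<^sup>+\<omega>. \<integral>\<^sup>+z. g (Y \<omega>, z) \<partial>distr M T Z \<partial>M)"
proof -
  note [measurable] = indep_pairD(1,2)[OF indep] g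
  interpret Z: prob_space "distr M T Z" by (rule prob_space_distr) measurable
  have "(\<integral>\<^sup>+\<omega>. g (Y \<omega>, Z \<omega>) \<partial>M) = (\<integral>\<^sup>+u. g u \<partial>distr M (S \<Otimes>\<^sub>M T) (\<lambda>\<omega>. (Y \<omega>, Z \<omega>)))"
    by (simp add: nn_integral_distr)
  also have "\<dots> = (\<integral>\<^sup>+u. g u \<partial>(distr M S Y \<Otimes>\<^sub>M distr M T Z))"
    using indep_pairD(3)[OF indep] by simp
  also have "\<dots> = (\<integral>\<^sup>+y. \<integral>\<^sup>+z. g (y, z) \<partial>distr M T Z \<partial>distr M S Y)"
    by (subst Z.nn_integral_fst[symmetric]) (simp_all cong: measurable_cong_sets sets_pair_measure_cong)
  also have "\<dots> = (\<integral>\<^sup>+\<omega>. \<integral>\<^sup>+z. g (Y \<omega>, z) \<partial>distr M T Z \<partial>M)"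
    by (subst nn_integral_distr) (simp_all cong: measurable_cong_sets sets_pair_measure_cong)
  finally show ?thesis .
qed

section \<open>The plug-in likelihood ratio of one bit\<close>

text \<open>Equality can fail because the left side is 0 for \<open>y = 0\<close> and for
  \<open>y = \<top>\<close>. The case \<open>y = 0\<close> is a bit that is impossible before the
  change.\<close>

lemma ennreal_divide_mult_le: "(x / y) * y \<le> (x :: ennreal)"
  by (cases "y = 0 \<or> y = \<top>") (auto simp: ennreal_divide_times less_top)

text \<open>The rays are the sections of two half-planes, and section measures depend measurably on
  the base point. This is what allows a random threshold as the endpoint.\<close>

lemma borel_measurable_emeasure_rays:
  fixes D :: "real measure"
  assumes "sigma_finite_measure D" and [measurable_cong]: "sets D = sets borel"
  shows "(\<lambda>u. emeasure D {..u}) \<in> borel_measurable borel"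
    and "(\<lambda>u. emeasure D {u<..}) \<in> borel_measurable borel"
proof -
  interpret sigma_finite_measure D by fact
  have "space D = UNIV" using sets_eq_imp_space_eq[OF assms(2)] by simp
  moreover have "{v \<in> space ((borel :: real measure) \<Otimes>\<^sub>M D). snd v \<le> fst v} \<in> sets (borel \<Otimes>\<^sub>M D)"
    and "{v \<in> space ((borel :: real measure) \<Otimes>\<^sub>M D). fst v < snd v} \<in> sets (borel \<Otimes>\<^sub>M D)"
    by measurable
  ultimately have Dm: "{v. snd v \<le> fst v} \<in> sets ((borel :: real measure) \<Otimes>\<^sub>M D)"
      "{v. fst v < snd v} \<in> sets ((borel :: real measure) \<Otimes>\<^sub>M D)"
    by (simp_all add: space_pair_measure)
  have "(\<lambda>u. emeasure D (Pair u -` {v. snd v \<le> fst v})) \<in> borel_measurable (borel :: real measure)"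
    by (rule measurable_emeasure_Pair) (use Dm in auto)
  then show "(\<lambda>u. emeasure D {..u}) \<in> borel_measurable borel"
    by (simp add: vimage_def atMost_def)
  have "(\<lambda>u. emeasure D (Pair u -` {v. fst v < snd v})) \<in> borel_measurable (borel :: real measure)"
    by (rule measurable_emeasure_Pair) (use Dm in auto)
  then show "(\<lambda>u. emeasure D {u<..}) \<in> borel_measurable borel"
    by (simp add: vimage_def greaterThan_def)
qed

text \<open>A plug-in likelihood ratio has conditional expectation at most \<open>1\<close>; it can be strictly
  less than \<open>1\<close>, when the true law gives probability \<open>0\<close> to one of the bits.\<close>
lemma (in prob_space) nn_integral_bit_ratio_le:
  fixes Z \<tau> :: "'a \<Rightarrow> real" and f r1 r2 :: "'a \<Rightarrow> ennreal"
  assumes indep: "indep_pair G (\<lambda>\<omega>. \<omega>) borel Z"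
    and [measurable]: "f \<in> borel_measurable G" "\<tau> \<in> borel_measurable G"
      "r1 \<in> borel_measurable G" "r2 \<in> borel_measurable G"
    and r: "\<And>\<omega>. \<omega> \<in> space M \<Longrightarrow> r1 \<omega> + r2 \<omega> \<le> 1"
  shows "(\<integral>\<^sup>+\<omega>. f \<omega> * (if Z \<omega> \<le> \<tau> \<omega> then r1 \<omega> / emeasure (distr M borel Z) {..\<tau> \<omega>}
      else r2 \<omega> / emeasure (distr M borel Z) {\<tau> \<omega><..}) \<partial>M) \<le> (\<integral>\<^sup>+\<omega>. f \<omega> \<partial>M)"
proof -
  let ?D = "distr M borel Z"
  have [measurable]: "random_variable borel Z"
    by (rule indep_pairD(2)[OF indep])
  interpret D: prob_space ?D by (rule prob_space_distr) measurable
  note [measurable] = borel_measurable_emeasure_rays[OF D.sigma_finite_measure_axioms sets_distr]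
  let ?s1 = "\<lambda>\<omega>. r1 \<omega> / emeasure ?D {..\<tau> \<omega>}" and ?s2 = "\<lambda>\<omega>. r2 \<omega> / emeasure ?D {\<tau> \<omega><..}"
  let ?g = "\<lambda>(\<omega>, x). f \<omega> * (if x \<le> \<tau> \<omega> then ?s1 \<omega> else ?s2 \<omega>)"
  have g: "?g \<in> borel_measurable (G \<Otimes>\<^sub>M borel)"
    by measurable
  have inner: "(\<integral>\<^sup>+x. ?g (\<omega>, x) \<partial>?D) \<le> f \<omega>" if "\<omega> \<in> space M" for \<omega>
  proof -
    have "(\<integral>\<^sup>+x. ?g (\<omega>, x) \<partial>?D) =
        f \<omega> * (\<integral>\<^sup>+x. ?s1 \<omega> * indicator {..\<tau> \<omega>} x + ?s2 \<omega> * indicator {\<tau> \<omega><..} x \<partial>?D)"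
      by (subst nn_integral_cmult[symmetric]) (auto intro!: nn_integral_cong simp: indicator_def)
    also have "\<dots> = f \<omega> * (?s1 \<omega> * emeasure ?D {..\<tau> \<omega>} + ?s2 \<omega> * emeasure ?D {\<tau> \<omega><..})"
      by (subst nn_integral_add) (auto simp: nn_integral_cmult_indicator simp del: emeasure_distr)
    also have "\<dots> \<le> f \<omega> * (r1 \<omega> + r2 \<omega>)"
      by (intro mult_left_mono add_mono ennreal_divide_mult_le) auto
    also have "\<dots> \<le> f \<omega> * 1"
      using r[OF that] by (intro mult_left_mono) auto
    finally show ?thesis by simp
  qed
  have "(\<integral>\<^sup>+\<omega>. ?g (\<omega>, Z \<omega>) \<partial>M) = (\<integral>\<^sup>+\<omega>. \<integral>\<^sup>+x. ?g (\<omega>, x) \<partial>?D \<partial>M)"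
    by (rule nn_integral_indep_pair[OF indep g])
  also have "\<dots> \<le> (\<integral>\<^sup>+\<omega>. f \<omega> \<partial>M)"
    by (intro nn_integral_mono inner)
  finally show ?thesis by simp
qed

section \<open>Bit probabilities as values of the law of an observation\<close>

text \<open>Links the law of an observation, a measure with values in \<open>ennreal\<close>, to the
  real integrals in \<open>p_B\<close>. The sign of \<open>f\<close> is known on \<X> only, hence
  the indicator in the density.\<close>

lemma density_on_emeasure:
  assumes f: "density_on \<X> f" and \<X>: "\<X> \<in> sets borel" and A: "A \<in> sets borel"
  shows "emeasure (density lborel (\<lambda>x. ennreal (indicator \<X> x * f x))) A =
    ennreal (LINT x:\<X> \<inter> A|lborel. f x)"
    and "set_integrable lborel (\<X> \<inter> A) f"
    and "0 \<le> (LINT x:\<X> \<inter> A|lborel. f x)"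
proof -
  have int: "set_integrable lborel \<X> f" and nn: "\<And>x. x \<in> \<X> \<Longrightarrow> 0 \<le> f x"
    using f by (auto simp: density_on_def)
  have [measurable]: "(\<lambda>x. indicator \<X> x * f x) \<in> borel_measurable borel"
    using int by (auto simp: set_integrable_def)
  show intA: "set_integrable lborel (\<X> \<inter> A) f"
    by (rule set_integrable_subset[OF int]) (use \<X> A in auto)
  show "0 \<le> (LINT x:\<X> \<inter> A|lborel. f x)"
    unfolding set_lebesgue_integral_def
    by (intro integral_nonneg_AE AE_I2) (auto simp: indicator_def nn)
  have "emeasure (density lborel (\<lambda>x. ennreal (indicator \<X> x * f x))) A =
      (\<integral>\<^sup>+x. ennreal (indicator \<X> x * f x) * indicator A x \<partial>lborel)"
    using A by (subst emeasure_density) auto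
  also have "\<dots> = (\<integral>\<^sup>+x. ennreal (indicator (\<X> \<inter> A) x *\<^sub>R f x) \<partial>lborel)"
    by (intro nn_integral_cong) (auto simp: indicator_def)
  also have "\<dots> = ennreal (LINT x:\<X> \<inter> A|lborel. f x)"
    unfolding set_lebesgue_integral_def
    by (intro nn_integral_eq_integral intA[unfolded set_integrable_def] AE_I2)
       (auto simp: indicator_def nn)
  finally show "emeasure (density lborel (\<lambda>x. ennreal (indicator \<X> x * f x))) A =
    ennreal (LINT x:\<X> \<inter> A|lborel. f x)" .
qed

lemma p_B_alt:
  "p_B p \<X> b \<theta> \<tau> = (LINT x:\<X> \<inter> (if b = 1 then {..\<tau>} else {\<tau><..})|lborel. p \<theta> x)"
  by (auto simp: p_B_def intro!: arg_cong[where f = "\<lambda>A. set_lebesgue_integral lborel A _"])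

lemma p_B_nonneg:
  assumes "density_on \<X> (p \<theta>)" "\<X> \<in> sets borel"
  shows "0 \<le> p_B p \<X> b \<theta> \<tau>"
  unfolding p_B_alt by (rule density_on_emeasure(3)[OF assms]) auto

lemma p_B_sum:
  assumes "density_on \<X> (p \<theta>)" "\<X> \<in> sets borel"
  shows "p_B p \<X> 1 \<theta> \<tau> + p_B p \<X> (-1) \<theta> \<tau> = 1"
proof -
  have "p_B p \<X> 1 \<theta> \<tau> + p_B p \<X> (-1) \<theta> \<tau> =
      (LINT x:(\<X> \<inter> {..\<tau>}) \<union> (\<X> \<inter> {\<tau><..})|lborel. p \<theta> x)"
    unfolding p_B_alt
    by (subst set_integral_Un) (auto intro: density_on_emeasure(2)[OF assms])
  also have "(\<X> \<inter> {..\<tau>}) \<union> (\<X> \<inter> {\<tau><..}) = \<X>" by auto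
  finally show ?thesis using assms by (simp add: density_on_def)
qed

section \<open>Domination of the CUSUM statistic\<close>

text \<open>One step of the comparison between the CUSUM statistic and the Shiryaev--Roberts statistic
  \<open>R\<close>: the invariant is \<open>exp (max S 0) \<le> 1 + R\<close>.\<close>
lemma cusum_step:
  fixes m p q c :: real and R :: ennreal
  assumes pq: "0 \<le> p" "0 \<le> q" and m: "ennreal (exp m) \<le> 1 + R"
    and c: "ereal c \<le> ereal m + elog (ereal p / ereal q)"
  shows "ennreal (exp c) \<le> (1 + R) * (ennreal p / ennreal q)"
proof (cases "p = 0 \<or> q = 0")
  \<comment> \<open>If \<open>p = 0\<close>, the increment is \<open>-\<infinity>\<close>, which the
    real number \<open>c\<close> excludes. What remains is \<open>q = 0 < p\<close>, where the right
    side is \<open>\<top>\<close>.\<close>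
  case True
  have "ereal 0 / ereal q = 0"
    unfolding zero_ereal_def[symmetric] divide_ereal_def by simp
  then have "elog (ereal 0 / ereal q) = -\<infinity>"
    by (simp only: elog_def order_refl if_True)
  then have "p \<noteq> 0"
    using c by (cases "p = 0") auto
  then show ?thesis
    using pq True by (auto simp: ennreal_divide_zero ennreal_mult_top)
next
  case False
  then have pos: "0 < p" "0 < q" using pq by auto
  then have "c \<le> m + ln (p / q)"
    using c divide_pos_pos[OF pos] by (simp add: elog_def not_le)
  then have "exp c \<le> exp m * (p / q)"
    using pos by (metis divide_pos_pos exp_add exp_le_cancel_iff exp_ln)
  then have "ennreal (exp c) \<le> ennreal (exp m) * (ennreal p / ennreal q)"
    using pos by (simp add: divide_ennreal ennreal_mult[symmetric])
  also have "\<dots> \<le> (1 + R) * (ennreal p / ennreal q)"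
    by (intro mult_right_mono m) auto
  finally show ?thesis .
qed

text \<open>Before the first alarm \<open>S\<close> is below \<open>ln \<gamma>\<close>, so
  \<open>max (S n) 0\<close> is a real number and the invariant can be propagated by
  \<open>cusum_step\<close>. Here \<open>p n\<close> and \<open>q n\<close> belong to the bit at
  time \<open>Suc n\<close>.\<close>

lemma cusum_dominated:
  fixes S :: "nat \<Rightarrow> ereal" and R :: "nat \<Rightarrow> ennreal" and p q :: "nat \<Rightarrow> real" and \<gamma> :: real
  assumes S: "S w = 0" "\<And>n. w \<le> n \<Longrightarrow> S (Suc n) = max (S n) 0 + elog (ereal (p n) / ereal (q n))"
    and R: "\<And>n. w \<le> n \<Longrightarrow> R (Suc n) = (1 + R n) * (ennreal (p n) / ennreal (q n))"
    and pq: "\<And>n. w \<le> n \<Longrightarrow> 0 \<le> p n" "\<And>n. w \<le> n \<Longrightarrow> 0 \<le> q n"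
    and \<gamma>: "0 < \<gamma>" and t: "w < t" "ereal (ln \<gamma>) \<le> S t" "\<And>s. w < s \<Longrightarrow> s < t \<Longrightarrow> S s < ereal (ln \<gamma>)"
  shows "ennreal \<gamma> \<le> R t"
proof -
  have inv: "\<exists>m. max (S n) 0 = ereal m \<and> ennreal (exp m) \<le> 1 + R n" if "w \<le> n" "n < t" for n
    using that
  proof (induction n rule: dec_induct)
    case base
    show ?case using S(1) by (intro exI[of _ 0]) (auto simp: zero_ereal_def)
  next
    case (step n)
    then obtain m where m: "max (S n) 0 = ereal m" "ennreal (exp m) \<le> 1 + R n" by auto
    have fin: "S (Suc n) < ereal (ln \<gamma>)" using t(3) step by simp
    show ?case
    proof (cases "S (Suc n) \<le> 0")
      \<comment> \<open>At a reset the summand 1 alone dominates \<open>exp 0\<close>.\<close>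
      case True
      then show ?thesis by (intro exI[of _ 0]) (auto simp: zero_ereal_def max_def)
    next
      case False
      then obtain c where c: "S (Suc n) = ereal c" using fin by (cases "S (Suc n)") auto
      have "ennreal (exp c) \<le> R (Suc n)"
        using cusum_step[OF pq m(2), of n n c] S(2)[of n] R[of n] step(1) m(1) c by simp
      also have "\<dots> \<le> 1 + R (Suc n)" by (simp add: add_increasing)
      finally show ?thesis using c False by (intro exI[of _ c]) (auto simp: max_def)
    qed
  qed
  obtain n where n: "t = Suc n" "w \<le> n" using t(1) by (cases t) auto
  then obtain m where m: "max (S n) 0 = ereal m" "ennreal (exp m) \<le> 1 + R n"
    using inv by auto
  \<comment> \<open>\<open>S t\<close> itself may be infinite, so the last step is taken with the
    real lower bound \<open>ln \<gamma>\<close> in place of its value.\<close>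
  have "ennreal (exp (ln \<gamma>)) \<le> R t"
    using cusum_step[OF pq m(2), of n n "ln \<gamma>"] S(2)[of n] R[of n] n m(1) t(2) by simp
  then show ?thesis using \<gamma> by simp
qed

section \<open>A lower bound for the expected crossing time\<close>

text \<open>No martingale convergence or optional stopping theorem is needed: summing the drift inequality
  over the event that \<open>R\<close> has not yet crossed \<open>\<gamma>\<close> bounds the crossing probability.\<close>
lemma (in prob_space) crossing_time_bound:
  fixes R :: "nat \<Rightarrow> 'a \<Rightarrow> ennreal" and \<gamma> :: real
  defines "N \<equiv> \<lambda>n. {\<omega> \<in> space M. \<forall>s\<le>n. R s \<omega> < ennreal \<gamma>}"
  assumes [measurable]: "\<And>n. R n \<in> borel_measurable M"
    and w: "w \<ge> 1" and \<gamma>: "\<gamma> > 0" and init: "\<And>n \<omega>. n \<le> w \<Longrightarrow> R n \<omega> = 0"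
    and drift: "\<And>n. w \<le> n \<Longrightarrow> (\<integral>\<^sup>+\<omega>. R (Suc n) \<omega> * indicator (N n) \<omega> \<partial>M) \<le>
        (\<integral>\<^sup>+\<omega>. (1 + R n \<omega>) * indicator (N n) \<omega> \<partial>M)"
    and T: "\<And>n \<omega>. \<omega> \<in> space M \<Longrightarrow> (\<Sum>k<n. indicator (N k) \<omega>) \<le> T \<omega>"
  shows "ennreal \<gamma> < (\<integral>\<^sup>+\<omega>. T \<omega> \<partial>M)"
proof -
  have N [measurable]: "N n \<in> sets M" for n
    unfolding N_def by measurable
  have anti: "N (Suc n) \<subseteq> N n" for n
    by (auto simp: N_def)
  have Nw: "N n = space M" if "n \<le> w" for n
    using that init \<gamma> by (auto simp: N_def)
  define a where "a n = (\<integral>\<^sup>+\<omega>. R n \<omega> * indicator (N n) \<omega> \<partial>M)" for n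
  have afin: "a n < \<top>" for n
  proof -
    have "a n \<le> (\<integral>\<^sup>+\<omega>. ennreal \<gamma> \<partial>M)"
      unfolding a_def by (intro nn_integral_mono) (auto simp: N_def indicator_def less_imp_le)
    then show ?thesis by (simp add: emeasure_space_1 le_less_trans[OF _ ennreal_less_top])
  qed
  \<comment> \<open>\<open>N n\<close> splits into the paths that cross at time n+1, where
    \<open>R (Suc n)\<close> is at least \<gamma>, and those that remain in
    \<open>N (Suc n)\<close>.\<close>
  have step: "ennreal \<gamma> * emeasure M (N n - N (Suc n)) + a (Suc n) \<le> emeasure M (N n) + a n"
    if "w \<le> n" for n
  proof -
    have "ennreal \<gamma> * emeasure M (N n - N (Suc n)) + a (Suc n) =
        (\<integral>\<^sup>+\<omega>. ennreal \<gamma> * indicator (N n - N (Suc n)) \<omega> + R (Suc n) \<omega> * indicator (N (Suc n)) \<omega> \<partial>M)"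
      unfolding a_def by (subst nn_integral_add) (auto simp: nn_integral_cmult_indicator)
    also have "\<dots> \<le> (\<integral>\<^sup>+\<omega>. R (Suc n) \<omega> * indicator (N n) \<omega> \<partial>M)"
    proof (intro nn_integral_mono)
      fix \<omega> assume \<omega>: "\<omega> \<in> space M"
      have "ennreal \<gamma> \<le> R (Suc n) \<omega>" if "\<omega> \<in> N n" "\<omega> \<notin> N (Suc n)"
        using that by (auto simp: N_def le_Suc_eq)
      then show "ennreal \<gamma> * indicator (N n - N (Suc n)) \<omega> + R (Suc n) \<omega> * indicator (N (Suc n)) \<omega>
          \<le> R (Suc n) \<omega> * indicator (N n) \<omega>"
        using anti[of n] by (auto simp: indicator_def)
    qed
    also have "\<dots> \<le> (\<integral>\<^sup>+\<omega>. (1 + R n \<omega>) * indicator (N n) \<omega> \<partial>M)"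
      by (rule drift[OF that])
    also have "\<dots> = emeasure M (N n) + a n"
      unfolding a_def by (simp add: distrib_right nn_integral_add)
    finally show ?thesis .
  qed
  define e where "e n = prob (N n)" for n
  have e: "0 \<le> e n" "e n \<le> 1" for n by (auto simp: e_def)
  have rstep: "\<gamma> * (e n - e (Suc n)) + enn2real (a (Suc n)) \<le> e n + enn2real (a n)" if "w \<le> n" for n
  proof -
    have "ennreal (\<gamma> * (e n - e (Suc n)) + enn2real (a (Suc n))) =
        ennreal \<gamma> * emeasure M (N n - N (Suc n)) + a (Suc n)"
      using \<gamma> afin anti[of n] finite_measure_mono[OF anti[of n]]
      by (simp add: e_def emeasure_eq_measure finite_measure_Diff ennreal_mult ennreal_enn2real)
    also have "\<dots> \<le> ennreal (e n + enn2real (a n))"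
      using step[OF that] afin by (simp add: e_def emeasure_eq_measure ennreal_enn2real)
    finally show ?thesis 
      by (rule iffD1[OF ennreal_le_iff, rotated]) (intro add_nonneg_nonneg e enn2real_nonneg)
  qed
  \<comment> \<open>Telescoping \<open>rstep\<close> from \<open>w\<close>, where
    \<open>e w = 1\<close> and \<open>a w = 0\<close>.\<close>
  have sum: "\<gamma> * (1 - e n) + enn2real (a n) \<le> (\<Sum>k=w..<n. e k)" if "w \<le> n" for n
    using that
  proof (induction n rule: dec_induct)
    case base
    show ?case by (simp add: e_def Nw prob_space a_def init)
  next
    case (step n)
    then show ?case using rstep[of n] by (simp add: algebra_simps)
  qed
  have T_ge: "ennreal (\<Sum>k<n. e k) \<le> (\<integral>\<^sup>+\<omega>. T \<omega> \<partial>M)" for n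
  proof -
    have "ennreal (\<Sum>k<n. e k) = (\<integral>\<^sup>+\<omega>. (\<Sum>k<n. indicator (N k) \<omega>) \<partial>M)"
      by (simp add: nn_integral_sum e_def emeasure_eq_measure)
    also have "\<dots> \<le> (\<integral>\<^sup>+\<omega>. T \<omega> \<partial>M)" by (intro nn_integral_mono T)
    finally show ?thesis .
  qed
  \<comment> \<open>The first \<open>w\<close> terms equal 1, so the partial sum is at least
    \<open>w + \<gamma> * (1 - e n)\<close>, which exceeds \<gamma> once
    \<open>\<gamma> * e n < w\<close>. If that never happens, non-crossing keeps probability at
    least \<open>w / \<gamma>\<close> and the sum diverges.\<close>
  have main: "\<exists>n. \<gamma> < (\<Sum>k<n. e k)"
  proof (cases "\<exists>n\<ge>w. \<gamma> * e n < w")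
    case True
    then obtain n where n: "w \<le> n" "\<gamma> * e n < w" by blast
    have "(\<Sum>k<n. e k) = (\<Sum>k<w. e k) + (\<Sum>k=w..<n. e k)"
      using n(1) sum.atLeastLessThan_concat[of 0 w n e] by (simp add: atLeast0LessThan)
    also have "(\<Sum>k<w. e k) = w"
      by (simp add: e_def Nw prob_space)
    finally have "(\<Sum>k<n. e k) \<ge> w + \<gamma> * (1 - e n)"
      using sum[OF n(1)] enn2real_nonneg[of "a n"] by linarith
    then show ?thesis using n(2) by (intro exI[of _ n]) (simp add: algebra_simps)
  next
    case False
    \<comment> \<open>The constant is the smaller of \<open>1 / \<gamma>\<close>, which serves for
      \<open>n \<ge> w\<close>, and 1, which serves for \<open>n < w\<close>.\<close>
    have lower: "1 / \<gamma> * min 1 \<gamma> \<le> e n" for n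
    proof (cases "w \<le> n")
      case True
      then have "real w \<le> \<gamma> * e n" using False by (simp add: not_less)
      then have "1 \<le> \<gamma> * e n" using w by linarith
      then show ?thesis using \<gamma> by (simp add: field_simps)
    qed (use \<gamma> in \<open>simp add: e_def Nw prob_space field_simps\<close>)
    obtain n where n: "\<gamma> / (1 / \<gamma> * min 1 \<gamma>) < real n" using reals_Archimedean2 by blast
    then have "\<gamma> < real n * (1 / \<gamma> * min 1 \<gamma>)"
      using \<gamma> by (subst (asm) pos_divide_less_eq) auto
    also have "\<dots> \<le> (\<Sum>k<n. e k)"
      using sum_mono[of "{..<n}", OF lower] by simp
    finally show ?thesis by blast
  qed
  then obtain n where "\<gamma> < (\<Sum>k<n. e k)" by blast
  then have "ennreal \<gamma> < ennreal (\<Sum>k<n. e k)"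
    using \<gamma> by (simp add: ennreal_less_iff)
  then show ?thesis using T_ge[of n] by (rule less_le_trans)
qed

section \<open>The algebra of raw observations and initial thresholds\<close>

text \<open>Independence of the next observation from \<open>history\<close> is inherited from this larger algebra,
  which is generated by independent variables instead of adaptively quantized ones.\<close>
definition obs_algebra ::
  "'a set \<Rightarrow> nat \<Rightarrow> (nat \<Rightarrow> 'a \<Rightarrow> real) \<Rightarrow> (nat \<Rightarrow> 'a \<Rightarrow> real) \<Rightarrow> nat \<Rightarrow> 'a measure" where
  "obs_algebra \<Omega> w \<tau> X n = vimage_algebra \<Omega> (\<lambda>\<omega>. (init_thresholds w \<tau> \<omega>, \<lambda>s\<in>{1..n}. X s \<omega>))
     (Pi\<^sub>M {1..w} (\<lambda>_. borel) \<Otimes>\<^sub>M Pi\<^sub>M {1..n} (\<lambda>_. borel))"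

lemma space_obs_algebra [simp]: "space (obs_algebra \<Omega> w \<tau> X n) = \<Omega>"
  by (simp add: obs_algebra_def)

lemma measurable_obs_algebra:
  shows "init_thresholds w \<tau> \<in> obs_algebra \<Omega> w \<tau> X n \<rightarrow>\<^sub>M Pi\<^sub>M {1..w} (\<lambda>_. borel)"
    and "s \<in> {1..n} \<Longrightarrow> X s \<in> borel_measurable (obs_algebra \<Omega> w \<tau> X n)"
    and "s \<in> {1..w} \<Longrightarrow> \<tau> s \<in> borel_measurable (obs_algebra \<Omega> w \<tau> X n)"
proof -
  let ?N = "Pi\<^sub>M {1..w} (\<lambda>_. borel :: real measure)" and ?P = "Pi\<^sub>M {1..n} (\<lambda>_. borel :: real measure)"
  have pair: "(\<lambda>\<omega>. (init_thresholds w \<tau> \<omega>, \<lambda>s\<in>{1..n}. X s \<omega>)) \<in> obs_algebra \<Omega> w \<tau> X n \<rightarrow>\<^sub>M ?N \<Otimes>\<^sub>M ?P"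
    unfolding obs_algebra_def
    by (rule measurable_vimage_algebra1) (auto simp: space_pair_measure space_PiM init_thresholds_def)
  show U: "init_thresholds w \<tau> \<in> obs_algebra \<Omega> w \<tau> X n \<rightarrow>\<^sub>M ?N"
    using measurable_compose[OF pair measurable_fst] by simp
  have V: "(\<lambda>\<omega>. \<lambda>s\<in>{1..n}. X s \<omega>) \<in> obs_algebra \<Omega> w \<tau> X n \<rightarrow>\<^sub>M ?P"
    using measurable_compose[OF pair measurable_snd] by simp
  show "X s \<in> borel_measurable (obs_algebra \<Omega> w \<tau> X n)" if "s \<in> {1..n}"
    using measurable_compose[OF V measurable_component_singleton[OF that]] that by simp
  show "\<tau> s \<in> borel_measurable (obs_algebra \<Omega> w \<tau> X n)" if "s \<in> {1..w}"
    using measurable_compose[OF U measurable_component_singleton[OF that]] that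
    by (simp add: init_thresholds_def)
qed

lemma obs_algebra_mono:
  assumes "m \<le> n"
  shows "sets (obs_algebra \<Omega> w \<tau> X m) \<subseteq> sets (obs_algebra \<Omega> w \<tau> X n)"
proof -
  have "(\<lambda>\<omega>. (init_thresholds w \<tau> \<omega>, \<lambda>s\<in>{1..m}. X s \<omega>)) \<in>
      obs_algebra \<Omega> w \<tau> X n \<rightarrow>\<^sub>M Pi\<^sub>M {1..w} (\<lambda>_. borel) \<Otimes>\<^sub>M Pi\<^sub>M {1..m} (\<lambda>_. borel)"
    using assms by (intro measurable_Pair measurable_obs_algebra(1) measurable_restrict measurable_obs_algebra(2)) auto
  then show ?thesis
    unfolding obs_algebra_def[of \<Omega> w \<tau> X m] by (intro sets_image_in_sets) auto
qed

text \<open>Bits depend on thresholds and adaptive thresholds on earlier bits. Strong induction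
  breaks the circle: for \<open>s > w\<close> the threshold \<open>\<tau> s\<close> is measurable
  for the history at \<open>s - 1\<close>, while the initial thresholds generate part of the algebra
  directly.\<close>

lemma history_subset_obs_algebra:
  assumes B: "B = (\<lambda>t \<omega>. one_bit (X t \<omega>) (\<tau> t \<omega>))"
    and \<tau>: "\<And>t. t > w \<Longrightarrow> \<tau> t \<in> borel_measurable (history \<Omega> w B \<tau> (t - 1))"
  shows "sets (history \<Omega> w B \<tau> n) \<subseteq> sets (obs_algebra \<Omega> w \<tau> X n)"
proof (induction n rule: less_induct)
  case (less n)
  let ?H = "obs_algebra \<Omega> w \<tau> X n"
  have \<tau>H: "\<tau> s \<in> borel_measurable ?H" if s: "s \<in> {1..n}" for s
  proof (cases "s \<le> w")
    case True
    then show ?thesis using s by (intro measurable_obs_algebra(3)) auto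
  next
    case False
    have "sets (history \<Omega> w B \<tau> (s - 1)) \<subseteq> sets ?H"
      by (rule order_trans[OF less obs_algebra_mono]) (use s in auto)
    then show ?thesis
      using \<tau>[of s] False by (auto simp: measurable_def)
  qed
  have BH: "B s \<in> ?H \<rightarrow>\<^sub>M count_space UNIV" if s: "s \<in> {1..n}" for s
  proof -
    note [measurable] = \<tau>H[OF s] measurable_obs_algebra(2)[OF s, where X = X]
    show ?thesis unfolding B one_bit_def by measurable
  qed
  have "sets (bit_sigma \<Omega> B n) \<subseteq> sets ?H"
    unfolding bit_sigma_def by (intro sets_image_in_sets measurable_restrict BH) auto
  moreover have "sets (vimage_algebra \<Omega> (init_thresholds w \<tau>) (Pi\<^sub>M {1..w} (\<lambda>_. borel))) \<subseteq> sets ?H"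
    by (intro sets_image_in_sets measurable_obs_algebra(1)) auto
  ultimately have sub: "sets (bit_sigma \<Omega> B n) \<union>
      sets (vimage_algebra \<Omega> (init_thresholds w \<tau>) (Pi\<^sub>M {1..w} (\<lambda>_. borel))) \<subseteq> sets ?H" (is "?E \<subseteq> _")
    by blast
  moreover have "?E \<subseteq> Pow \<Omega>"
    by (rule order_trans[OF sub]) (use sets.space_closed[of ?H] in simp)
  ultimately show ?case
    unfolding history_def using sets.sigma_sets_subset[of ?E ?H] by simp
qed

lemma (in prob_space) indep_pair_obs_algebra:
  assumes X: "indep_vars (\<lambda>_. borel) X {1..}"
    and init: "indep_var (Pi\<^sub>M {1..w} (\<lambda>_. borel)) (init_thresholds w \<tau>)
      (Pi\<^sub>M {1..} (\<lambda>_. borel)) (\<lambda>\<omega>. \<lambda>t\<in>{1..}. X t \<omega>)"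
  shows "indep_pair (obs_algebra (space M) w \<tau> X n) (\<lambda>\<omega>. \<omega>) borel (X (Suc n))"
proof -
  let ?N = "Pi\<^sub>M {1..w} (\<lambda>_. borel :: real measure)" and ?P = "Pi\<^sub>M {1..n} (\<lambda>_. borel :: real measure)"
  let ?V = "\<lambda>\<omega>. \<lambda>s\<in>{1..n}. X s \<omega>"
  have pair_of_var: "indep_pair S Y T Z" if "indep_var S Y T Z"
    for S T :: "(nat \<Rightarrow> real) measure" and Y Z
    using that by (simp add: indep_pair_def indep_var_distribution_eq)
  have sub: "(\<lambda>v. (restrict v {1..n}, v (Suc n))) \<in> Pi\<^sub>M {1..} (\<lambda>_. borel) \<rightarrow>\<^sub>M ?P \<Otimes>\<^sub>M (borel :: real measure)"
    by (intro measurable_Pair measurable_restrict_subset measurable_component_singleton) auto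
  have "indep_pair ?N (init_thresholds w \<tau>) (?P \<Otimes>\<^sub>M borel) (\<lambda>\<omega>. (?V \<omega>, X (Suc n) \<omega>))"
    using indep_pair_compose[OF pair_of_var[OF init] measurable_ident sub]
    by (simp add: restrict_restrict Int_absorb1 subset_eq cong: restrict_cong)
  moreover have "indep_pair ?P ?V borel (X (Suc n))"
  proof -
    \<comment> \<open>The next observation is wrapped as a function on \<open>{Suc n}\<close> to
      give both variables the same type; the projection then unwraps it.\<close>
    have "indep_var ?P ?V (Pi\<^sub>M {Suc n} (\<lambda>_. borel)) (\<lambda>\<omega>. \<lambda>s\<in>{Suc n}. X s \<omega>)"
      by (rule indep_var_restrict[OF X]) auto
    from indep_pair_compose[OF pair_of_var[OF this] measurable_ident
        measurable_component_singleton[of "Suc n"]]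
    show ?thesis by simp
  qed
  ultimately show ?thesis
    unfolding obs_algebra_def by (intro indep_pair_vimage_algebra indep_pair_assoc)
qed

section \<open>The average run length of the procedure\<close>

theorem lemma1:
  fixes M :: "'a measure"
    and \<X> \<Theta> \<Theta>1 :: "real set"
    and p :: "real \<Rightarrow> real \<Rightarrow> real"
    and \<theta>0 \<tau>min \<tau>max \<gamma> :: real
    and w :: nat
    and X \<tau> \<theta>h :: "nat \<Rightarrow> 'a \<Rightarrow> real"
  defines "B \<equiv> (\<lambda>t \<omega>. one_bit (X t \<omega>) (\<tau> t \<omega>))"
  defines "G \<equiv> history (space M) w B \<tau>"
  defines "T \<equiv> stop_time w (ln \<gamma>) (cusum_stat p \<X> \<theta>0 w B \<tau> \<theta>h)"
  assumes prob: "prob_space M"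
    and \<X>: "\<X> \<in> sets borel"
    and family: "\<And>\<theta>. \<theta> \<in> \<Theta> \<Longrightarrow> density_on \<X> (p \<theta>)"
    and \<theta>0: "\<theta>0 \<in> \<Theta>"
    and \<Theta>1: "\<Theta>1 \<subseteq> \<Theta>" "compact \<Theta>1" "\<theta>0 \<notin> \<Theta>1"
    and \<tau>_range: "\<tau>min \<in> \<X>" "\<tau>max \<in> \<X>"
    and w: "w \<ge> 1"
    and \<gamma>: "\<gamma> > 1"
    \<comment> \<open>the no-change regime: the observations are i.i.d. with density \<open>p \<theta>0\<close> on \<open>\<X>\<close>\<close>
    and X_indep: "prob_space.indep_vars M (\<lambda>_. borel) X {1..}"
    and X_distr: "\<And>t. t \<ge> 1 \<Longrightarrow>
          distributed M lborel (X t) (\<lambda>x. ennreal (indicator \<X> x * p \<theta>0 x))"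
    \<comment> \<open>the initial thresholds are random and independent of the observations\<close>
    and init_indep: "prob_space.indep_var M
          (Pi\<^sub>M {1..w} (\<lambda>_. borel)) (init_thresholds w \<tau>)
          (Pi\<^sub>M {1..} (\<lambda>_. borel)) (\<lambda>\<omega>. \<lambda>t\<in>{1..}. X t \<omega>)"
    and \<tau>_in: "\<And>t \<omega>. t \<ge> 1 \<Longrightarrow> \<omega> \<in> space M \<Longrightarrow> \<tau> t \<omega> \<in> {\<tau>min..\<tau>max} \<inter> interior \<X>"
    and \<theta>h_argmax: "\<And>t \<omega>. t > w \<Longrightarrow> \<omega> \<in> space M \<Longrightarrow>
          is_arg_max (window_loglik p \<X> w B \<tau> t \<omega>) (\<lambda>\<theta>. \<theta> \<in> \<Theta>1) (\<theta>h (t - 1) \<omega>)"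
    and \<tau>_argmax: "\<And>t \<omega>. t > w \<Longrightarrow> \<omega> \<in> space M \<Longrightarrow>
          is_arg_max (KL_bit p \<X> \<theta>0 (\<theta>h (t - 1) \<omega>)) (\<lambda>u. u \<in> {\<tau>min..\<tau>max}) (\<tau> t \<omega>)"
    \<comment> \<open>predictability; the last condition is automatic when estimate and threshold depend on the
        bits only, see \<open>history_finite_comp\<close>\<close>
    and \<theta>h_meas: "\<And>t. t > w \<Longrightarrow> \<theta>h (t - 1) \<in> borel_measurable (G (t - 1))"
    and \<tau>_meas: "\<And>t. t > w \<Longrightarrow> \<tau> t \<in> borel_measurable (G (t - 1))"
    and plugin_meas: "\<And>t b. t > w \<Longrightarrow> b \<in> {-1, 1} \<Longrightarrow>
          (\<lambda>\<omega>. p_B p \<X> b (\<theta>h (t - 1) \<omega>) (\<tau> t \<omega>)) \<in> borel_measurable (G (t - 1))"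
  shows "(\<integral>\<^sup>+ \<omega>. ennreal_of_enat (T \<omega>) \<partial>M) > ennreal \<gamma>"
proof -
  interpret prob_space M by (rule prob)
  define H where "H = obs_algebra (space M) w \<tau> X"
  have GH: "sets (G n) \<subseteq> sets (H n)" for n
    unfolding G_def H_def
    using \<tau>_meas unfolding G_def by (intro history_subset_obs_algebra) (simp_all only: B_def)
  have H_mono: "borel_measurable (H m) \<subseteq> borel_measurable (H n)" if "m \<le> n" for m n
    unfolding H_def by (intro measurable_mono obs_algebra_mono that) simp_all
  have GH_meas: "borel_measurable (G n) \<subseteq> borel_measurable (H n)" for n
    by (intro measurable_mono GH) (simp_all add: G_def H_def)
  have indep: "indep_pair (H n) (\<lambda>\<omega>. \<omega>) borel (X (Suc n))" for n
    unfolding H_def by (rule indep_pair_obs_algebra[OF X_indep init_indep])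
  \<comment> \<open>That the identity is a random variable into \<open>H n\<close> says that
    \<open>H n\<close> is a subalgebra of \<open>M\<close>.\<close>
  have HM: "f \<in> borel_measurable M" if "f \<in> borel_measurable (H n)" for f :: "'a \<Rightarrow> ennreal" and n
    using measurable_compose[OF indep_pairD(1)[OF indep] that] by simp

  define D where "D t = distr M borel (X t)" for t
  have D: "D t = density lborel (\<lambda>x. ennreal (indicator \<X> x * p \<theta>0 x))" if "1 \<le> t" for t
    using X_distr[OF that] distr_cong[of M M borel lborel "X t" "X t"]
    by (simp add: D_def distributed_def)
  have D_le: "emeasure (D t) {..u} = ennreal (p_B p \<X> 1 \<theta>0 u)"
    and D_gt: "emeasure (D t) {u<..} = ennreal (p_B p \<X> (-1) \<theta>0 u)" if "1 \<le> t" for t u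
    using density_on_emeasure(1)[OF family[OF \<theta>0] \<X>] by (simp_all add: D[OF that] p_B_alt)
  have \<theta>h_in: "\<theta>h n \<omega> \<in> \<Theta>" if "w \<le> n" "\<omega> \<in> space M" for n \<omega>
    using \<theta>h_argmax[of "Suc n" \<omega>] that \<Theta>1(1) by (auto simp: is_arg_max_def)

  define P where "P t \<omega> = p_B p \<X> (B t \<omega>) (\<theta>h (t - 1) \<omega>) (\<tau> t \<omega>)" for t \<omega>
  define Q where "Q t \<omega> = p_B p \<X> (B t \<omega>) \<theta>0 (\<tau> t \<omega>)" for t \<omega>
  define L where "L t \<omega> = ennreal (P t \<omega>) / ennreal (Q t \<omega>)" for t \<omega>
  \<comment> \<open>\<open>P t\<close> contains the bit at time \<open>t\<close>, whereas
    \<open>r b t\<close> fixes its value and is thus known at time \<open>t - 1\<close>.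
    \<open>L_alt\<close> isolates the new observation in a single comparison.\<close>
  define r where "r b t \<omega> = ennreal (p_B p \<X> b (\<theta>h (t - 1) \<omega>) (\<tau> t \<omega>))" for b t \<omega>
  have L_alt: "L t \<omega> = (if X t \<omega> \<le> \<tau> t \<omega> then r 1 t \<omega> / emeasure (D t) {..\<tau> t \<omega>}
      else r (-1) t \<omega> / emeasure (D t) {\<tau> t \<omega><..})" if "1 \<le> t" for t \<omega>
    by (simp add: L_def P_def Q_def r_def B_def one_bit_def D_le[OF that] D_gt[OF that])
  have Suc_ge1: "1 \<le> Suc n" for n by simp
  have r_sum: "r 1 (Suc n) \<omega> + r (-1) (Suc n) \<omega> \<le> 1" if "w \<le> n" "\<omega> \<in> space M" for n \<omega>
    using family[OF \<theta>h_in[OF that]]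
    by (simp add: r_def p_B_sum p_B_nonneg \<X> ennreal_plus[symmetric] del: ennreal_plus)
  have r_meas: "r b (Suc n) \<in> borel_measurable (H n)" if "w \<le> n" "b \<in> {-1, 1}" for b n
    using plugin_meas[of "Suc n" b] that GH_meas[of n] unfolding r_def
    by (intro measurable_compose[OF _ measurable_ennreal]) auto
  have \<tau>_measH: "\<tau> (Suc n) \<in> borel_measurable (H n)" if "w \<le> n" for n
    using \<tau>_meas[of "Suc n"] that GH_meas[of n] by auto

  \<comment> \<open>The test \<open>n < w\<close> governs index \<open>Suc n\<close>, so
    \<open>R\<close> vanishes up to and including \<open>w\<close>, and the first ratio to enter is
    \<open>L (Suc w)\<close>.\<close>
  define R where "R n \<omega> = rec_nat 0 (\<lambda>n x. if n < w then 0 else (1 + x) * L (Suc n) \<omega>) n" for n \<omega>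
  have R0: "R n \<omega> = 0" if "n \<le> w" for n \<omega>
    using that by (cases n) (auto simp: R_def)
  have R_Suc: "R (Suc n) \<omega> = (1 + R n \<omega>) * L (Suc n) \<omega>" if "w \<le> n" for n \<omega>
    using that by (simp add: R_def)
  have R_meas: "R n \<in> borel_measurable (H n)" for n
  proof (induction n)
    case 0
    then show ?case by (simp add: R_def)
  next
    case (Suc n)
    show ?case
    proof (cases "w \<le> n")
      case True
      interpret D: prob_space "D (Suc n)"
        unfolding D_def by (rule prob_space_distr[OF indep_pairD(2)[OF indep]])
      have sD: "sets (D (Suc n)) = sets borel" by (simp add: D_def)
      note [measurable] = borel_measurable_emeasure_rays[OF D.sigma_finite_measure_axioms sD]
      have [measurable]: "R n \<in> borel_measurable (H (Suc n))"
          "\<tau> (Suc n) \<in> borel_measurable (H (Suc n))"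
          "r 1 (Suc n) \<in> borel_measurable (H (Suc n))" "r (-1) (Suc n) \<in> borel_measurable (H (Suc n))"
        using Suc \<tau>_measH r_meas H_mono[of n "Suc n"] True by (auto simp: subset_eq)
      have [measurable]: "X (Suc n) \<in> borel_measurable (H (Suc n))"
        unfolding H_def by (rule measurable_obs_algebra) auto
      have "(\<lambda>\<omega>. (1 + R n \<omega>) * L (Suc n) \<omega>) \<in> borel_measurable (H (Suc n))"
        unfolding L_alt[OF Suc_ge1] by measurable
      moreover have "R (Suc n) = (\<lambda>\<omega>. (1 + R n \<omega>) * L (Suc n) \<omega>)"
        using R_Suc[OF True] by (rule ext)
      ultimately show ?thesis by (simp only:)
    next
      case False
      then have "R (Suc n) = (\<lambda>\<omega>. 0)"
        by (intro ext R0) simp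
      then show ?thesis by simp
    qed
  qed

  define N where "N n = {\<omega> \<in> space M. \<forall>s\<le>n. R s \<omega> < ennreal \<gamma>}" for n
  \<comment> \<open>Membership in \<open>H n\<close> lets the indicator join the past-measurable
    factor that multiplies \<open>L (Suc n)\<close>.\<close>
  have N_H: "N n \<in> sets (H n)" for n
  proof -
    have [measurable]: "R s \<in> borel_measurable (H n)" if "s \<le> n" for s
      using R_meas[of s] H_mono[OF that] by auto
    have "N n = {\<omega> \<in> space (H n). \<forall>s\<in>{..n}. R s \<omega> < ennreal \<gamma>}"
      by (auto simp: N_def H_def)
    also have "\<dots> \<in> sets (H n)" by measurable
    finally show ?thesis .
  qed

  show ?thesis
  proof (rule crossing_time_bound[where R = R and w = w])
    show "R n \<in> borel_measurable M" for n by (rule HM[OF R_meas])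
    show "w \<ge> 1" "0 < \<gamma>" using w \<gamma> by auto
    show "R n \<omega> = 0" if "n \<le> w" for n \<omega> by (rule R0[OF that])
  next
    fix n assume n: "w \<le> n"
    have f: "(\<lambda>\<omega>. (1 + R n \<omega>) * indicator (N n) \<omega>) \<in> borel_measurable (H n)"
      using R_meas[of n] N_H[of n] by measurable
    have "(\<integral>\<^sup>+\<omega>. R (Suc n) \<omega> * indicator (N n) \<omega> \<partial>M) =
        (\<integral>\<^sup>+\<omega>. ((1 + R n \<omega>) * indicator (N n) \<omega>) * L (Suc n) \<omega> \<partial>M)"
      by (simp only: R_Suc[OF n] mult.assoc mult.commute[of "L _ _"])
    also have "\<dots> \<le> (\<integral>\<^sup>+\<omega>. (1 + R n \<omega>) * indicator (N n) \<omega> \<partial>M)"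
      unfolding L_alt[OF Suc_ge1] D_def
      by (rule nn_integral_bit_ratio_le[OF indep f \<tau>_measH r_meas r_meas r_sum]) (use n in auto)
    finally show "(\<integral>\<^sup>+\<omega>. R (Suc n) \<omega> * indicator {\<omega> \<in> space M. \<forall>s\<le>n. R s \<omega> < ennreal \<gamma>} \<omega> \<partial>M)
        \<le> (\<integral>\<^sup>+\<omega>. (1 + R n \<omega>) * indicator {\<omega> \<in> space M. \<forall>s\<le>n. R s \<omega> < ennreal \<gamma>} \<omega> \<partial>M)"
      by (simp add: N_def)
  next
    fix n \<omega> assume \<omega>: "\<omega> \<in> space M"
    let ?S = "\<lambda>t. cusum_stat p \<X> \<theta>0 w B \<tau> \<theta>h t \<omega>"
    let ?A = "{t. t > w \<and> ?S t \<ge> ereal (ln \<gamma>)}"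
    have "(\<Sum>k<n. indicator (N k) \<omega>) \<le> ennreal_of_enat (T \<omega>)"
    proof (cases "?A = {}")
      case True
      then have "T \<omega> = \<infinity>" by (simp add: T_def stop_time_def Inf_enat_def)
      then show ?thesis by simp
    next
      case False
      define t where "t = (LEAST t. t \<in> ?A)"
      have t: "t \<in> ?A" unfolding t_def by (rule LeastI_ex) (use False in blast)
      have t_least: "t \<le> s" if "s \<in> ?A" for s
        unfolding t_def using that by (rule Least_le)
      have T: "T \<omega> = enat t"
        unfolding T_def stop_time_def using t t_least
        by (intro antisym Inf_lower Inf_greatest) auto
      have "ennreal \<gamma> \<le> R t \<omega>"
      proof (rule cusum_dominated[where S = ?S and w = w and R = "\<lambda>n. R n \<omega>"])
        show "?S w = 0" using w by (cases w) auto
        show "?S (Suc n) = max (?S n) 0 + elog (ereal (P (Suc n) \<omega>) / ereal (Q (Suc n) \<omega>))" if "w \<le> n" for n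
          using that by (simp add: log_ratio_def P_def Q_def)
        show "R (Suc n) \<omega> = (1 + R n \<omega>) * (ennreal (P (Suc n) \<omega>) / ennreal (Q (Suc n) \<omega>))" if "w \<le> n" for n
          using R_Suc[OF that] by (simp add: L_def)
        show "0 \<le> P (Suc n) \<omega>" if "w \<le> n" for n
          unfolding P_def using family[OF \<theta>h_in[OF that \<omega>]] by (simp add: p_B_nonneg \<X>)
        show "0 \<le> Q (Suc n) \<omega>" for n
          unfolding Q_def using family[OF \<theta>0] by (simp add: p_B_nonneg \<X>)
        show "0 < \<gamma>" using \<gamma> by simp
        show "w < t" "ereal (ln \<gamma>) \<le> ?S t" using t by auto
        show "?S s < ereal (ln \<gamma>)" if "w < s" "s < t" for s
          using t_least[of s] that by (auto simp: not_le[symmetric])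
      qed
      \<comment> \<open>\<open>R\<close> may cross \<gamma> before the alarm, but not after it.
        Hence at most the \<open>t\<close> indices 0, ..., t-1 are uncrossed, which bounds
        \<open>T\<close> from below.\<close>
      then have "k < t" if "\<omega> \<in> N k" for k
        using that by (force simp: N_def not_less[symmetric] intro: ccontr)
      then have "indicator (N k) \<omega> \<le> (indicator {..<t} k :: ennreal)" for k
        by (auto simp: indicator_def)
      then have "(\<Sum>k<n. indicator (N k) \<omega>) \<le> (\<Sum>k<n. indicator {..<t} k :: ennreal)"
        by (rule sum_mono)
      also have "\<dots> = of_nat (card ({..<n} \<inter> {..<t}))"
        by (simp add: indicator_def sum.If_cases lessThan_def Int_def)
      also have "\<dots> \<le> of_nat t"
        by (intro of_nat_mono) (metis card_lessThan card_mono finite_lessThan inf_le2)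
      finally show ?thesis by (simp add: T)
    qed
    then show "(\<Sum>k<n. indicator {\<omega> \<in> space M. \<forall>s\<le>k. R s \<omega> < ennreal \<gamma>} \<omega>) \<le> ennreal_of_enat (T \<omega>)"
      by (simp add: N_def)
  qed
qed

end
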